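(* Suppose that $$f_\alpha(x,y,\mathbf 0)\le0,\qquad g_\alpha(x,y)\ge0,\qquad f_\alpha(x,y,u)\ge-M_\alpha\ \text{ for } u\ge0,\qquad \alpha=1,2,$$ where $M_1,M_2$ are positive constants. Let $\widehat U(x_i,y_j)=0$ for $(x_i,y_j)\in\overline\Omega^h$, and let $\widetilde U=(\widetilde U_1,\widetilde U_2)$ be the solution of the linear problems $$\mathcal L_{\alpha,ij}\widetilde U_\alpha(x_i,y_j)=M_\alpha,\quad (x_i,y_j)\in\Omega^h,\ \alpha=1,2;\qquad \widetilde U(x_i,y_j)=g(x_i,y_j),\quad (x_i,y_j)\in\partial\Omega^h.$$ Then $\widehat U$ and $\widetilde U$ are, respectively, ordered lower and upper solutions of the nonlinear difference scheme (defined in the context), such that $$\widehat U(x_i,y_j)\le\widetilde U(x_i,y_j),\qquad (x_i,y_j)\in\overline\Omega^h.$$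
   Context: Let $\omega=(0,1)\times(0,1)$, let $\varepsilon_1,\varepsilon_2>0$ be constants, and let $v_\alpha(x,y)\ge0$ on $\overline\omega$, $f_\alpha(x,y,u)$ ($(x,y)\in\overline\omega$, $u=(u_1,u_2)$), and $g=(g_1,g_2)$ on $\partial\omega$, $\alpha=1,2$, be smooth functions. Inequalities between vectors and vector functions are understood componentwise. Mesh: $\overline\Omega^h=\{(x_i,y_j):0\le i\le N_x,\ 0\le j\le N_y\}$ with $x_i=ih_x$, $y_j=jh_y$, $h_x=1/N_x$, $h_y=1/N_y$; $\Omega^h$ is the set of interior mesh points ($1\le i\le N_x-1$, $1\le j\le N_y-1$) and $\partial\Omega^h=\overline\Omega^h\setminus\Omega^h$. For a mesh function $U=(U_1,U_2)$ put $U_{\alpha,ij}=U_\alpha(x_i,y_j)$. For an interior mesh point define $$\mathcal L_{\alpha,ij}U_\alpha(x_i,y_j)=-\varepsilon_\alpha\left(\frac{U_{\alpha,i-1,j}-2U_{\alpha,ij}+U_{\alpha,i+1,j}}{h_x^2}+\frac{U_{\alpha,i,j-1}-2U_{\alpha,ij}+U_{\alpha,i,j+1}}{h_y^2}\right)+v_\alpha(x_i,y_j)\left(\frac{U_{\alpha,ij}-U_{\alpha,i-1,j}}{h_x}+\frac{U_{\alpha,ij}-U_{\alpha,i,j-1}}{h_y}\right).$$ The nonlinear difference scheme is $$\mathcal L_{\alpha,ij}U_\alpha(x_i,y_j)+f_\alpha(x_i,y_j,U)=0,\ (x_i,y_j)\in\Omega^h,\ \alpha=1,2;\qquad U(x_i,y_j)=g(x_i,y_j),\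 (x_i,y_j)\in\partial\Omega^h.$$ Mesh functions $\widetilde U=(\widetilde U_1,\widetilde U_2)$ and $\widehat U=(\widehat U_1,\widehat U_2)$ are ordered upper and lower solutions of this scheme if $\widetilde U\ge\widehat U$ on $\overline\Omega^h$; $\mathcal L_{\alpha,ij}\widetilde U_\alpha(x_i,y_j)+f_\alpha(x_i,y_j,\widetilde U)\ge0$ and $\mathcal L_{\alpha,ij}\widehat U_\alpha(x_i,y_j)+f_\alpha(x_i,y_j,\widehat U)\le0$ on $\Omega^h$ for $\alpha=1,2$; and $\widehat U\le g\le\widetilde U$ on $\partial\Omega^h$. *)

theory Defs
  imports "HOL-Analysis.Analysis"
begin

text \<open>
  The components \<open>\<alpha> = 1, 2\<close> are indexed by the two-element type \<open>2\<close>. The order on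
  \<open>real ^ 2\<close> is the library's componentwise order.
\<close>

text \<open>
  Intended for open \<open>S\<close>: all directional derivatives up to order \<open>k\<close> exist and are continuous,
  those of order below \<open>k\<close> being Frechet differentiable.
\<close>

primrec times_differentiable_on ::
  "nat \<Rightarrow> 'a::real_normed_vector set \<Rightarrow> ('a \<Rightarrow> 'b::real_normed_vector) \<Rightarrow> bool" where
  "times_differentiable_on 0 S F \<longleftrightarrow> continuous_on S F"
| "times_differentiable_on (Suc k) S F \<longleftrightarrow>
     (\<forall>x\<in>S. F differentiable (at x)) \<and>
     (\<forall>d. times_differentiable_on k S (\<lambda>x. frechet_derivative F (at x) d))"

text \<open>
  On a set that need not be open, smooth means being the restriction of a function of class
  C-infinity on an open neighbourhood.
\<close>

definition smooth_on ::
  "'a::real_normed_vector set \<Rightarrow> ('a \<Rightarrow> 'b::real_normed_vector) \<Rightarrow> bool" where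
  "smooth_on S F \<longleftrightarrow>
     (\<exists>T G. open T \<and> S \<subseteq> T \<and> (\<forall>k. times_differentiable_on k T G) \<and> (\<forall>x\<in>S. G x = F x))"

definition omega :: "(real \<times> real) set" where
  "omega = {0<..<1} \<times> {0<..<1}"

text \<open>
  Mesh points are addressed by their index pairs, and a mesh function is a function of the two
  indices: \<open>U i j\<close> is the value at the point \<open>mesh_point Nx Ny i j\<close>. Values at indices outside
  \<open>mesh Nx Ny\<close> play no role.
\<close>

definition mesh_step :: "nat \<Rightarrow> real" where
  "mesh_step N = 1 / real N"

definition mesh_point :: "nat \<Rightarrow> nat \<Rightarrow> nat \<Rightarrow> nat \<Rightarrow> real \<times> real" where
  "mesh_point Nx Ny i j = (real i * mesh_step Nx, real j * mesh_step Ny)"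

definition mesh :: "nat \<Rightarrow> nat \<Rightarrow> (nat \<times> nat) set" where
  "mesh Nx Ny = {(i, j). i \<le> Nx \<and> j \<le> Ny}"

definition mesh_interior :: "nat \<Rightarrow> nat \<Rightarrow> (nat \<times> nat) set" where
  "mesh_interior Nx Ny = {(i, j). 1 \<le> i \<and> i \<le> Nx - 1 \<and> 1 \<le> j \<and> j \<le> Ny - 1}"

definition mesh_boundary :: "nat \<Rightarrow> nat \<Rightarrow> (nat \<times> nat) set" where
  "mesh_boundary Nx Ny = mesh Nx Ny - mesh_interior Nx Ny"

definition diff_op ::
  "nat \<Rightarrow> nat \<Rightarrow> (2 \<Rightarrow> real) \<Rightarrow> (2 \<Rightarrow> real \<times> real \<Rightarrow> real) \<Rightarrow> 2 \<Rightarrow> (nat \<Rightarrow> nat \<Rightarrow> real ^ 2)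
     \<Rightarrow> nat \<Rightarrow> nat \<Rightarrow> real" where
  "diff_op Nx Ny \<epsilon> v \<alpha> U i j =
     - \<epsilon> \<alpha> * ((U (i - 1) j $ \<alpha> - 2 * U i j $ \<alpha> + U (i + 1) j $ \<alpha>) / (mesh_step Nx)\<^sup>2
             + (U i (j - 1) $ \<alpha> - 2 * U i j $ \<alpha> + U i (j + 1) $ \<alpha>) / (mesh_step Ny)\<^sup>2)
     + v \<alpha> (mesh_point Nx Ny i j) *
         ((U i j $ \<alpha> - U (i - 1) j $ \<alpha>) / mesh_step Nx
          + (U i j $ \<alpha> - U i (j - 1) $ \<alpha>) / mesh_step Ny)"

definition ordered_upper_lower_solutions ::
  "nat \<Rightarrow> nat \<Rightarrow> (2 \<Rightarrow> real) \<Rightarrow> (2 \<Rightarrow> real \<times> real \<Rightarrow> real)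
     \<Rightarrow> (2 \<Rightarrow> real \<times> real \<Rightarrow> real ^ 2 \<Rightarrow> real) \<Rightarrow> (real \<times> real \<Rightarrow> real ^ 2)
     \<Rightarrow> (nat \<Rightarrow> nat \<Rightarrow> real ^ 2) \<Rightarrow> (nat \<Rightarrow> nat \<Rightarrow> real ^ 2) \<Rightarrow> bool" where
  "ordered_upper_lower_solutions Nx Ny \<epsilon> v f g Uup Ulow \<longleftrightarrow>
     (\<forall>(i, j) \<in> mesh Nx Ny. Ulow i j \<le> Uup i j) \<and>
     (\<forall>\<alpha>. \<forall>(i, j) \<in> mesh_interior Nx Ny.
        diff_op Nx Ny \<epsilon> v \<alpha> Uup i j + f \<alpha> (mesh_point Nx Ny i j) (Uup i j) \<ge> 0 \<and>
        diff_op Nx Ny \<epsilon> v \<alpha> Ulow i j + f \<alpha> (mesh_point Nx Ny i j) (Ulow i j) \<le> 0) \<and>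
     (\<forall>(i, j) \<in> mesh_boundary Nx Ny.
        Ulow i j \<le> g (mesh_point Nx Ny i j) \<and> g (mesh_point Nx Ny i j) \<le> Uup i j)"

end

theory Submission
  imports Defs
begin

text \<open>
  At a minimum over the mesh attained in the interior, every neighbour is at least as large, so the
  diffusion and the upwind convection terms are both nonpositive; this contradicts
  \<open>\<L>\<^sub>\<alpha> U\<^sub>\<alpha> = M\<^sub>\<alpha> > 0\<close>. Hence the minimum lies on the boundary, where \<open>g \<ge> 0\<close>.
\<close>

text \<open>Only the signs of quotients depend on this, and division by zero gives 0, so the weak
  inequality suffices for every \<open>N\<close>.\<close>

lemma mesh_step_nonneg: "mesh_step N \<ge> 0"
  by (simp add: mesh_step_def)

lemma closure_omega: "closure omega = {0..1} \<times> {0..1}"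
  by (simp add: omega_def closure_Times)

lemma frontier_omega: "frontier omega = {0..1} \<times> {0..1} - {0<..<1} \<times> {0<..<1}"
proof -
  have "open omega"
    by (simp add: omega_def open_Times)
  then show ?thesis
    by (simp add: frontier_def interior_open closure_omega) (simp add: omega_def)
qed

lemma mesh_point_in_closure_omega:
  assumes "Nx \<ge> 1" and "Ny \<ge> 1" and "(i, j) \<in> mesh Nx Ny"
  shows "mesh_point Nx Ny i j \<in> closure omega"
  using assms by (auto simp: closure_omega mesh_point_def mesh_step_def mesh_def)

lemma mesh_point_in_frontier_omega:
  assumes "Nx \<ge> 1" and "Ny \<ge> 1" and "(i, j) \<in> mesh_boundary Nx Ny"
  shows "mesh_point Nx Ny i j \<in> frontier omega"
proof -
  have "(i, j) \<in> mesh Nx Ny" and "i = 0 \<or> i = Nx \<or> j = 0 \<or> j = Ny"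
    using assms(3) by (auto simp: mesh_boundary_def mesh_def mesh_interior_def)
  moreover have "mesh_point Nx Ny i j \<in> {0..1} \<times> {0..1}"
    using mesh_point_in_closure_omega[OF assms(1,2) calculation(1)] by (simp add: closure_omega)
  ultimately show ?thesis
    using assms(1,2) by (auto simp: frontier_omega mesh_point_def mesh_step_def)
qed

text \<open>The five-point stencil stays inside the mesh; as interior indices are at least 1, the
  truncated \<open>i - 1\<close> and \<open>j - 1\<close> are true predecessors.\<close>

lemma mesh_neighbours:
  assumes "(i, j) \<in> mesh_interior Nx Ny"
  shows "(i, j) \<in> mesh Nx Ny" "(i - 1, j) \<in> mesh Nx Ny" "(i + 1, j) \<in> mesh Nx Ny"
    "(i, j - 1) \<in> mesh Nx Ny" "(i, j + 1) \<in> mesh Nx Ny"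
  using assms by (auto simp: mesh_interior_def mesh_def)

lemma diff_op_nonpos_at_minimum:
  assumes "\<epsilon> \<alpha> \<ge> 0" and "v \<alpha> (mesh_point Nx Ny i j) \<ge> 0"
    and "(i, j) \<in> mesh_interior Nx Ny"
    and min: "\<And>k l. (k, l) \<in> mesh Nx Ny \<Longrightarrow> U i j $ \<alpha> \<le> U k l $ \<alpha>"
  shows "diff_op Nx Ny \<epsilon> v \<alpha> U i j \<le> 0"
proof -
  note nb = mesh_neighbours[OF assms(3), THEN min]
  \<comment> \<open>Each second difference is the sum of two increments from the minimum to a
    neighbour, both nonnegative.\<close>
  have "0 \<le> \<epsilon> \<alpha> * ((U (i - 1) j $ \<alpha> - 2 * U i j $ \<alpha> + U (i + 1) j $ \<alpha>) / (mesh_step Nx)\<^sup>2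
             + (U i (j - 1) $ \<alpha> - 2 * U i j $ \<alpha> + U i (j + 1) $ \<alpha>) / (mesh_step Ny)\<^sup>2)"
    using nb
    by (intro mult_nonneg_nonneg assms(1) add_nonneg_nonneg[OF divide_nonneg_nonneg divide_nonneg_nonneg])
      auto
  \<comment> \<open>The differences are backward, hence nonpositive at a minimum; multiplying by
    \<open>v\<close> keeps this sign because \<open>v\<close> is nonnegative.\<close>
  moreover have "v \<alpha> (mesh_point Nx Ny i j) *
         ((U i j $ \<alpha> - U (i - 1) j $ \<alpha>) / mesh_step Nx
          + (U i j $ \<alpha> - U i (j - 1) $ \<alpha>) / mesh_step Ny) \<le> 0"
    using nb
    by (intro mult_nonneg_nonpos add_nonpos_nonpos divide_nonpos_nonneg mesh_step_nonneg assms(2)) auto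
  ultimately show ?thesis
    by (simp add: diff_op_def)
qed

text \<open>Since \<open>pos\<close> is strict, one interior minimum point is already contradictory;
  the minimum need not be propagated from neighbour to neighbour up to the boundary.\<close>

lemma discrete_minimum_principle:
  assumes "\<epsilon> \<alpha> \<ge> 0"
    and v: "\<And>i j. (i, j) \<in> mesh_interior Nx Ny \<Longrightarrow> v \<alpha> (mesh_point Nx Ny i j) \<ge> 0"
    and pos: "\<And>i j. (i, j) \<in> mesh_interior Nx Ny \<Longrightarrow> diff_op Nx Ny \<epsilon> v \<alpha> U i j > 0"
    and bdry: "\<And>i j. (i, j) \<in> mesh_boundary Nx Ny \<Longrightarrow> c \<le> U i j $ \<alpha>"
    and "(i, j) \<in> mesh Nx Ny"
  shows "c \<le> U i j $ \<alpha>"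
proof -
  have "mesh Nx Ny = {..Nx} \<times> {..Ny}"
    by (auto simp: mesh_def)
  then have "finite (mesh Nx Ny)"
    by simp
  then obtain p where p: "is_arg_min (\<lambda>(k, l). U k l $ \<alpha>) (\<lambda>q. q \<in> mesh Nx Ny) p"
    using ex_is_arg_min_if_finite[of "mesh Nx Ny"] assms(5) by blast
  obtain a b where "p = (a, b)"
    by fastforce
  with p have ab: "(a, b) \<in> mesh Nx Ny"
    and min: "\<And>k l. (k, l) \<in> mesh Nx Ny \<Longrightarrow> U a b $ \<alpha> \<le> U k l $ \<alpha>"
    by (auto simp: is_arg_min_linorder)
  have "(a, b) \<notin> mesh_interior Nx Ny"
  proof
    assume "(a, b) \<in> mesh_interior Nx Ny"
    then have "diff_op Nx Ny \<epsilon> v \<alpha> U a b \<le> 0"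
      using assms(1) v min by (intro diff_op_nonpos_at_minimum)
    with pos[OF \<open>(a, b) \<in> mesh_interior Nx Ny\<close>] show False
      by simp
  qed
  then have "c \<le> U a b $ \<alpha>"
    using ab bdry by (simp add: mesh_boundary_def)
  also have "\<dots> \<le> U i j $ \<alpha>"
    using assms(5) by (rule min)
  finally show ?thesis .
qed

text \<open>The lower solution is prescribed only at mesh indices, so it cannot be replaced by the
  zero function; the stencil reads no other values.\<close>

lemma diff_op_eq_0_if_zero_on_mesh:
  assumes "\<And>k l. (k, l) \<in> mesh Nx Ny \<Longrightarrow> U k l = 0" and "(i, j) \<in> mesh_interior Nx Ny"
  shows "diff_op Nx Ny \<epsilon> v \<alpha> U i j = 0"
  using mesh_neighbours[OF assms(2), THEN assms(1)] by (simp add: diff_op_def)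

theorem lemma3:
  fixes Nx Ny :: nat
    and \<epsilon> M :: "2 \<Rightarrow> real"
    and v :: "2 \<Rightarrow> real \<times> real \<Rightarrow> real"
    and f :: "2 \<Rightarrow> real \<times> real \<Rightarrow> real ^ 2 \<Rightarrow> real"
    and g :: "real \<times> real \<Rightarrow> real ^ 2"
    and Ulow Uup :: "nat \<Rightarrow> nat \<Rightarrow> real ^ 2"
  assumes "Nx \<ge> 1" and "Ny \<ge> 1"
    and "\<And>\<alpha>. \<epsilon> \<alpha> > 0"
    and "\<And>\<alpha>. smooth_on (closure omega) (v \<alpha>)"
    and "\<And>\<alpha> p. p \<in> closure omega \<Longrightarrow> v \<alpha> p \<ge> 0"
    and "\<And>\<alpha>. smooth_on (closure omega \<times> UNIV) (\<lambda>(p, u). f \<alpha> p u)"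
    and "smooth_on (frontier omega) g"
    and "\<And>\<alpha>. M \<alpha> > 0"
    and "\<And>\<alpha> p. p \<in> closure omega \<Longrightarrow> f \<alpha> p 0 \<le> 0"
    and "\<And>\<alpha> p. p \<in> frontier omega \<Longrightarrow> g p $ \<alpha> \<ge> 0"
    and "\<And>\<alpha> p u. p \<in> closure omega \<Longrightarrow> u \<ge> 0 \<Longrightarrow> f \<alpha> p u \<ge> - M \<alpha>"
    and "\<And>i j. (i, j) \<in> mesh Nx Ny \<Longrightarrow> Ulow i j = 0"
    and "\<And>\<alpha> i j. (i, j) \<in> mesh_interior Nx Ny \<Longrightarrow> diff_op Nx Ny \<epsilon> v \<alpha> Uup i j = M \<alpha>"
    and "\<And>i j. (i, j) \<in> mesh_boundary Nx Ny \<Longrightarrow> Uup i j = g (mesh_point Nx Ny i j)"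
  shows "ordered_upper_lower_solutions Nx Ny \<epsilon> v f g Uup Ulow
    \<and> (\<forall>(i, j) \<in> mesh Nx Ny. Ulow i j \<le> Uup i j)"
proof -
  note closure_pt = mesh_point_in_closure_omega[OF assms(1,2)]
  note frontier_pt = mesh_point_in_frontier_omega[OF assms(1,2)]
  have boundary_in_mesh: "(i, j) \<in> mesh Nx Ny" if "(i, j) \<in> mesh_boundary Nx Ny" for i j
    using that by (simp add: mesh_boundary_def)
  have Uup_nonneg: "Uup i j \<ge> 0" if "(i, j) \<in> mesh Nx Ny" for i j
  proof -
    \<comment> \<open>The linear problems decouple: \<open>diff_op\<close> for \<alpha> reads only
      component \<alpha>, so the scalar principle applies to each component with
      \<open>c = 0\<close>.\<close>
    have "0 \<le> Uup i j $ \<alpha>" for \<alpha>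
    proof (rule discrete_minimum_principle[of \<epsilon> \<alpha> Nx Ny v])
      show "\<epsilon> \<alpha> \<ge> 0"
        using assms(3) by (simp add: less_imp_le)
      show "v \<alpha> (mesh_point Nx Ny k l) \<ge> 0" if "(k, l) \<in> mesh_interior Nx Ny" for k l
        using that by (intro assms(5) closure_pt mesh_neighbours(1))
      show "diff_op Nx Ny \<epsilon> v \<alpha> Uup k l > 0" if "(k, l) \<in> mesh_interior Nx Ny" for k l
        using assms(8,13) that by simp
      show "0 \<le> Uup k l $ \<alpha>" if "(k, l) \<in> mesh_boundary Nx Ny" for k l
        using assms(10,14) frontier_pt that by simp
    qed (fact that)
    then show ?thesis
      by (simp add: less_eq_vec_def)
  qed
  have ordered: "\<forall>(i, j) \<in> mesh Nx Ny. Ulow i j \<le> Uup i j"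
    using assms(12) Uup_nonneg by auto
  have upper: "diff_op Nx Ny \<epsilon> v \<alpha> Uup i j + f \<alpha> (mesh_point Nx Ny i j) (Uup i j) \<ge> 0"
    if "(i, j) \<in> mesh_interior Nx Ny" for \<alpha> i j
    \<comment> \<open>Nonnegativity of \<open>Uup\<close> places it where \<open>f\<close> is at
      least \<open>- M \<alpha>\<close>, which the right-hand side \<open>M \<alpha>\<close> of the
      linear problem compensates.\<close>
    using assms(11)[OF closure_pt Uup_nonneg, OF mesh_neighbours(1,1), OF that that, of \<alpha>]
      assms(13)[OF that, of \<alpha>] by simp
  have lower: "diff_op Nx Ny \<epsilon> v \<alpha> Ulow i j + f \<alpha> (mesh_point Nx Ny i j) (Ulow i j) \<le> 0"
    if "(i, j) \<in> mesh_interior Nx Ny" for \<alpha> i j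
    \<comment> \<open>The difference operator vanishes, leaving the sign of \<open>f\<close> at
      zero.\<close>
    using diff_op_eq_0_if_zero_on_mesh[OF assms(12) that]
      assms(9)[OF closure_pt] assms(12) mesh_neighbours(1)[OF that] by simp
  have boundary: "Ulow i j \<le> g (mesh_point Nx Ny i j) \<and> g (mesh_point Nx Ny i j) \<le> Uup i j"
    if "(i, j) \<in> mesh_boundary Nx Ny" for i j
    \<comment> \<open>As \<open>Uup\<close> equals \<open>g\<close> here, the upper bound is an
      equality and the lower bound is the ordering itself.\<close>
    using assms(14)[OF that] ordered boundary_in_mesh[OF that] by auto
  show ?thesis
    unfolding ordered_upper_lower_solutions_def
    using ordered upper lower boundary by auto
qed

end
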